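(* Let $\mathcal{H}$ be a nonzero real Hilbert space, and let $C$ and $D$ be nonempty convex subsets of $\mathcal{H}$ such that $C\neq\{0\}$ and $D\neq\{0\}$. Set $$\alpha:=\sup\{\langle x,y\rangle : x\in\overline{\operatorname{cone}}(C)\cap\mathbf{S}_{\mathcal{H}},\ y\in\overline{\operatorname{cone}}(D)\cap\mathbf{S}_{\mathcal{H}}\},$$ $$\beta:=\inf\{\|x-y\| : x\in\overline{\operatorname{cone}}(C)\cap\mathbf{S}_{\mathcal{H}},\ y\in\overline{\operatorname{cone}}(D)\cap\mathbf{S}_{\mathcal{H}}\},$$ $$\gamma:=\inf\left\{\frac{\|x-y\|}{\|x\|+\|y\|} : x\in\overline{\operatorname{cone}}(C),\ y\in\overline{\operatorname{cone}}(D),\ (x,y)\neq(0,0)\right\}.$$ Then the following hold: (i) $c_0(C,D)=\sup\left\{\sqrt{\langle P_{\overline{\operatorname{cone}}(C)}x,\ P_{\overline{\operatorname{cone}}(D)}P_{\overline{\operatorname{cone}}(C)}x\rangle} : x\in\mathbf{S}_{\mathcal{H}}\right\}$. (ii) If $c_0(C,D)\neq 0$, then $c_0(C,D)=\alpha=1-\frac{\beta^2}{2}=1-2\gamma^2$.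
   Context: $\mathbf{B}_{\mathcal{H}}=\{x\in\mathcal{H}:\|x\|\le 1\}$ and $\mathbf{S}_{\mathcal{H}}=\{x\in\mathcal{H}:\|x\|=1\}$. A set $A\subseteq\mathcal{H}$ is a cone if $A=\mathbb{R}_{++}A$, where $\mathbb{R}_{++}=\{\lambda\in\mathbb{R}:\lambda>0\}$. $\overline{\operatorname{cone}}(A)$ is the smallest closed cone containing $A$; for $A$ convex it equals the closure of $\mathbb{R}_{++}A$. For a nonempty closed convex set $A$, $P_A$ is the projector (nearest-point map) onto $A$. For nonempty convex sets $C,D\subseteq\mathcal{H}$, the cosine of the minimal angle between $C$ and $D$ is $$c_0(C,D):=\sup\{\langle x,y\rangle : x\in\overline{\operatorname{cone}}(C)\cap\mathbf{B}_{\mathcal{H}},\ y\in\overline{\operatorname{cone}}(D)\cap\mathbf{B}_{\mathcal{H}}\}.$$ *)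

theory Defs
  imports "HOL-Analysis.Analysis"
begin

definition pos_scalings :: "'a::real_vector set \<Rightarrow> 'a set"
  where "pos_scalings A = {r *\<^sub>R x | r x. r > 0 \<and> x \<in> A}"

(* Only strictly positive scalars are used, so a cone need not contain 0;
   the library predicate "cone" is closed under the scalar 0 as well. *)
definition pos_cone :: "'a::real_vector set \<Rightarrow> bool"
  where "pos_cone A \<longleftrightarrow> A = pos_scalings A"

definition closed_cone_hull :: "'a::real_normed_vector set \<Rightarrow> 'a set"
  where "closed_cone_hull A = (\<lambda>K. closed K \<and> pos_cone K) hull A"

lemma pos_cone_iff: "pos_cone A \<longleftrightarrow> (\<forall>x\<in>A. \<forall>r>0. r *\<^sub>R x \<in> A)"
proof -
  have "x \<in> pos_scalings A" if "x \<in> A" for x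
    unfolding pos_scalings_def using that by (auto intro!: exI[of _ "1::real"] exI[of _ x])
  then show ?thesis
    unfolding pos_cone_def by (auto simp: pos_scalings_def set_eq_iff)
qed

(* The hull is itself a closed cone, hence the smallest one containing A. *)
lemma closed_cone_hull: "closed (closed_cone_hull A) \<and> pos_cone (closed_cone_hull A)"
  unfolding closed_cone_hull_def
  by (rule hull_in) (auto simp: pos_cone_iff)

(* Nearest-point map. The library's closest_point is restricted to Heine-Borel
   spaces, which excludes infinite-dimensional Hilbert spaces. For a nonempty
   closed convex A in a Hilbert space the description is uniquely satisfied. *)
definition projector :: "'a::real_inner set \<Rightarrow> 'a \<Rightarrow> 'a"
  where "projector A x = (THE p. p \<in> A \<and> (\<forall>y\<in>A. norm (x - p) \<le> norm (x - y)))"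

definition cos_min_angle :: "'a::real_inner set \<Rightarrow> 'a set \<Rightarrow> real"
  where "cos_min_angle C D =
    Sup {x \<bullet> y | x y. x \<in> closed_cone_hull C \<inter> cball 0 1 \<and> y \<in> closed_cone_hull D \<inter> cball 0 1}"

end

theory Submission
  imports Defs
begin

text \<open>
  Write \<open>K\<close> and \<open>L\<close> for the two closed convex cones. The residual of the projection of \<open>k\<close> onto \<open>L\<close> is
  orthogonal to that projection and has nonpositive inner product with every element of \<open>L\<close>. Hence
  the norm of the projection of \<open>k\<close> onto \<open>L\<close> is the supremum of the inner products of \<open>k\<close> with the
  elements of \<open>L\<close> in the unit ball. As each \<open>k\<close> in \<open>K\<close> is its own projection onto \<open>K\<close>, this gives (i).
  For (ii), the cosine \<open>c\<close> satisfies the homogeneous bound \<open>x \<bullet> y \<le> c * norm x * norm y\<close> on \<open>K\<close> and \<open>L\<close>,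
  and if \<open>c\<close> is positive, then it is also the supremum over the unit spheres; the formulas for \<open>\<beta>\<close>
  and \<open>\<gamma>\<close> follow by expanding the square of \<open>norm (x - y)\<close>.
\<close>

section \<open>Closed conical hulls\<close>

lemma closed_cone_hull_superset: "A \<subseteq> closed_cone_hull A"
  unfolding closed_cone_hull_def by (rule hull_subset)

lemma closed_cone_hull_scaleR: "x \<in> closed_cone_hull A \<Longrightarrow> r > 0 \<Longrightarrow> r *\<^sub>R x \<in> closed_cone_hull A"
  using closed_cone_hull[of A] by (simp add: pos_cone_iff)

lemma sgn_mem_closed_cone_hull: "x \<in> closed_cone_hull A \<Longrightarrow> x \<noteq> 0 \<Longrightarrow> sgn x \<in> closed_cone_hull A"
  unfolding sgn_div_norm by (rule closed_cone_hull_scaleR) auto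

text \<open>Positive scalings never reach 0, so closedness must supply it: 0 is the limit of the
  multiples of \<open>x\<close> by 1/(n+1).\<close>

lemma zero_mem_closed_cone_hull:
  assumes "A \<noteq> {}"
  shows "0 \<in> closed_cone_hull A"
proof -
  obtain x where x: "x \<in> closed_cone_hull A"
    using assms closed_cone_hull_superset by blast
  have lim: "(\<lambda>n. inverse (real (Suc n)) *\<^sub>R x) \<longlonglongrightarrow> 0 *\<^sub>R x"
    by (intro tendsto_intros LIMSEQ_inverse_real_of_nat)
  have "inverse (real (Suc n)) *\<^sub>R x \<in> closed_cone_hull A" for n
    using x by (intro closed_cone_hull_scaleR) auto
  then have "0 *\<^sub>R x \<in> closed_cone_hull A"
    by (rule closed_sequentially[OF conjunct1[OF closed_cone_hull] _ lim])
  then show ?thesis by simp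
qed

lemma cone_closed_cone_hull: "A \<noteq> {} \<Longrightarrow> cone (closed_cone_hull A)"
  unfolding cone_def using zero_mem_closed_cone_hull closed_cone_hull_scaleR
  by (metis order_le_less scaleR_zero_left)

lemma convex_pos_scalings:
  assumes "convex A"
  shows "convex (pos_scalings A)"
proof (rule convexI)
  fix x y and u v :: real
  assume "x \<in> pos_scalings A" "y \<in> pos_scalings A" and uv: "0 \<le> u" "0 \<le> v" "u + v = 1"
  then obtain r a s b where x: "x = r *\<^sub>R a" "r > 0" "a \<in> A" and y: "y = s *\<^sub>R b" "s > 0" "b \<in> A"
    unfolding pos_scalings_def by blast
  \<comment> \<open>\<open>t\<close> is the factor that makes the weights of \<open>a\<close> and
    \<open>b\<close> sum to 1 inside \<open>A\<close>.\<close>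
  define t where "t = u * r + v * s"
  have "t > 0"
    using uv x(2) y(2) unfolding t_def
    by (cases "u = 0") (auto intro: add_pos_nonneg)
  moreover have "(u * r / t) *\<^sub>R a + (v * s / t) *\<^sub>R b \<in> A"
    using uv x y \<open>t > 0\<close>
    by (intro convexD[OF assms]) (auto simp: t_def simp flip: add_divide_distrib)
  moreover have "u *\<^sub>R x + v *\<^sub>R y = t *\<^sub>R ((u * r / t) *\<^sub>R a + (v * s / t) *\<^sub>R b)"
    using \<open>t > 0\<close> by (simp add: x(1) y(1) scaleR_add_right)
  ultimately show "u *\<^sub>R x + v *\<^sub>R y \<in> pos_scalings A"
    unfolding pos_scalings_def by blast
qed

text \<open>The closure is still a cone, because scaling commutes with closure. This explicit form
  lets the hull inherit convexity from \<open>A\<close>.\<close>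

lemma closed_cone_hull_eq_closure: "closed_cone_hull A = closure (pos_scalings A)"
proof
  have "1 *\<^sub>R x \<in> pos_scalings A" if "x \<in> A" for x
    unfolding pos_scalings_def using that zero_less_one by blast
  then have "A \<subseteq> closure (pos_scalings A)"
    using closure_subset by fastforce
  moreover have "r *\<^sub>R x \<in> closure (pos_scalings A)"
    if "x \<in> closure (pos_scalings A)" "r > 0" for x r
  proof -
    have "r *\<^sub>R x \<in> closure ((*\<^sub>R) r ` pos_scalings A)"
      using that(1) closure_scaleR[of r "pos_scalings A"] by blast
    moreover have "(*\<^sub>R) r ` pos_scalings A \<subseteq> pos_scalings A"
      using that(2) unfolding pos_scalings_def
      by clarsimp (metis mult_pos_pos)
    ultimately show ?thesis
      using closure_mono by blast
  qed
  ultimately show "closed_cone_hull A \<subseteq> closure (pos_scalings A)"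
    unfolding closed_cone_hull_def by (intro hull_minimal) (auto simp: pos_cone_iff)
next
  have "pos_scalings A \<subseteq> closed_cone_hull A"
    using closed_cone_hull_scaleR closed_cone_hull_superset by (fastforce simp: pos_scalings_def)
  then show "closure (pos_scalings A) \<subseteq> closed_cone_hull A"
    using closed_cone_hull[of A] by (simp add: closure_minimal)
qed

lemma convex_closed_cone_hull: "convex A \<Longrightarrow> convex (closed_cone_hull A)"
  by (simp add: closed_cone_hull_eq_closure convex_closure convex_pos_scalings)

lemma closed_cone_hull_has_unit_vector:
  assumes "A \<noteq> {}" "A \<noteq> {0}"
  obtains x where "x \<in> closed_cone_hull A" "norm x = 1"
proof -
  obtain a where a: "a \<in> A" "a \<noteq> 0"
    using assms by blast
  then have "sgn a \<in> closed_cone_hull A"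
    using sgn_mem_closed_cone_hull closed_cone_hull_superset by blast
  with a that show thesis by (simp add: norm_sgn)
qed

section \<open>Projections onto closed convex sets and cones\<close>

lemma closest_point_exists_complete:
  fixes K :: "'a::{real_inner, complete_space} set"
  assumes "closed K" "convex K" "K \<noteq> {}"
  obtains p where "p \<in> K" "\<And>y. y \<in> K \<Longrightarrow> norm (x - p) \<le> norm (x - y)"
proof -
  define d where "d = infdist x K"
  \<comment> \<open>The points of \<open>K\<close> that are nearest up to 1/(n+1). These closed sets
    decrease and their diameters tend to 0, so completeness gives a common point, and that point
    attains the distance \<open>d\<close>.\<close>
  define S where "S n = K \<inter> cball x (d + inverse (real (Suc n)))" for n
  have d0: "0 \<le> d" by (simp add: d_def infdist_nonneg)
  have dle: "d \<le> norm (x - y)" if "y \<in> K" for y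
    using infdist_le[OF that, of x] by (simp add: d_def dist_norm)
  \<comment> \<open>Parallelogram identity for \<open>x - a\<close> and \<open>x - b\<close>, whose midpoint has norm at least \<open>d\<close>.\<close>
  have diam: "(dist a b)\<^sup>2 \<le> 4 * ((d + inverse (real (Suc n)))\<^sup>2 - d\<^sup>2)"
    if "a \<in> S n" "b \<in> S n" for a b n
  proof -
    let ?r = "d + inverse (real (Suc n))"
    have "(1/2) *\<^sub>R a + (1/2) *\<^sub>R b \<in> K"
      using that by (intro convexD[OF assms(2)]) (auto simp: S_def)
    then have "d\<^sup>2 \<le> (norm (x - ((1/2) *\<^sub>R a + (1/2) *\<^sub>R b)))\<^sup>2"
      using dle d0 by (intro power_mono) auto
    moreover have "(norm (x - a))\<^sup>2 \<le> ?r\<^sup>2" "(norm (x - b))\<^sup>2 \<le> ?r\<^sup>2"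
      using that by (auto simp: S_def dist_norm intro!: power_mono)
    moreover have "(dist a b)\<^sup>2 = 2 * (norm (x - a))\<^sup>2 + 2 * (norm (x - b))\<^sup>2
        - 4 * (norm (x - ((1/2) *\<^sub>R a + (1/2) *\<^sub>R b)))\<^sup>2"
      by (simp add: dist_norm power2_norm_eq_inner inner_diff_left inner_diff_right inner_add_left
          inner_add_right inner_commute algebra_simps)
    ultimately show ?thesis by simp
  qed
  have "(\<lambda>n. 4 * ((d + inverse (real (Suc n)))\<^sup>2 - d\<^sup>2)) \<longlonglongrightarrow> 4 * ((d + 0)\<^sup>2 - d\<^sup>2)"
    by (intro tendsto_intros LIMSEQ_inverse_real_of_nat)
  then have lim: "(\<lambda>n. 4 * ((d + inverse (real (Suc n)))\<^sup>2 - d\<^sup>2)) \<longlonglongrightarrow> 0"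
    by simp
  obtain p where p: "\<And>n. p \<in> S n"
  proof (rule decreasing_closed_nest[of S])
    show "closed (S n)" for n
      unfolding S_def using assms(1) by (intro closed_Int closed_cball)
    show "S n \<noteq> {}" for n
    proof -
      have "(INF a\<in>K. dist x a) < d + inverse (real (Suc n))"
        by (simp add: d_def infdist_notempty[OF assms(3)])
      then obtain a where "a \<in> K" "dist x a < d + inverse (real (Suc n))"
        using cInf_lessD[of "dist x ` K"] assms(3) by auto
      then show ?thesis by (force simp: S_def)
    qed
    show "S n \<subseteq> S m" if "m \<le> n" for m n
    proof -
      have "inverse (real (Suc n)) \<le> inverse (real (Suc m))"
        using that by (intro le_imp_inverse_le) auto
      then show ?thesis
        unfolding S_def by (intro Int_mono order_refl subset_cball add_left_mono)
    qed
    show "\<exists>n. \<forall>a\<in>S n. \<forall>b\<in>S n. dist a b < e" if "e > 0" for e :: real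
    proof -
      have "\<forall>\<^sub>F n in sequentially. 4 * ((d + inverse (real (Suc n)))\<^sup>2 - d\<^sup>2) < e\<^sup>2"
        using that by (intro order_tendstoD(2)[OF lim] zero_less_power)
      then obtain n where n: "4 * ((d + inverse (real (Suc n)))\<^sup>2 - d\<^sup>2) < e\<^sup>2"
        using eventually_happens'[OF sequentially_bot] by blast
      have "dist a b < e" if "a \<in> S n" "b \<in> S n" for a b
        by (rule power2_less_imp_less[OF le_less_trans[OF diam[OF that] n] less_imp_le[OF \<open>e > 0\<close>]])
      then show ?thesis by blast
    qed
  qed blast
  have "(\<lambda>n. d + inverse (real (Suc n))) \<longlonglongrightarrow> d + 0"
    by (intro tendsto_intros LIMSEQ_inverse_real_of_nat)
  moreover have p_mem: "p \<in> K" and "norm (x - p) \<le> d + inverse (real (Suc n))" for n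
    using p unfolding S_def Int_iff mem_cball dist_norm by blast+
  ultimately have "norm (x - p) \<le> d + 0"
    by (intro LIMSEQ_le_const) blast+
  with p_mem dle show thesis
    by (intro that[of p]) force+
qed

text \<open>The description in \<open>projector\<close> carries information only once its solution
  is unique: existence comes from completeness, uniqueness from convexity.\<close>

lemma
  fixes K :: "'a::{real_inner, complete_space} set"
  assumes "closed K" "convex K" "K \<noteq> {}"
  shows projector_mem: "projector K x \<in> K"
    and projector_le: "y \<in> K \<Longrightarrow> norm (x - projector K x) \<le> norm (x - y)"
proof -
  obtain p where p: "p \<in> K" "\<forall>y\<in>K. norm (x - p) \<le> norm (x - y)"
    using closest_point_exists_complete[OF assms] by metis
  have "\<exists>!p. p \<in> K \<and> (\<forall>y\<in>K. norm (x - p) \<le> norm (x - y))"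
    using p any_closest_point_unique[OF assms(2,1)] by (intro ex1I[of _ p]) (auto simp: dist_norm)
  from theI'[OF this] show "projector K x \<in> K"
    and "y \<in> K \<Longrightarrow> norm (x - projector K x) \<le> norm (x - y)"
    by (auto simp: projector_def)
qed

lemma projector_ident:
  fixes K :: "'a::{real_inner, complete_space} set"
  assumes "closed K" "convex K" "x \<in> K"
  shows "projector K x = x"
  using projector_le[OF assms(1,2) _ assms(3), of x] assms(3) by force

context
  fixes K :: "'a::{real_inner, complete_space} set"
  assumes K: "closed K" "convex K" "cone K" "K \<noteq> {}"
begin

lemma projector_dot:
  assumes "y \<in> K"
  shows "(x - projector K x) \<bullet> (y - projector K x) \<le> 0"
  using any_closest_point_dot[OF K(2,1) projector_mem[OF K(1,2,4)] assms] projector_le[OF K(1,2,4)]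
  by (auto simp: dist_norm)

lemma inner_projector_ge:
  assumes "v \<in> K"
  shows "x \<bullet> v \<le> projector K x \<bullet> v"
proof -
  \<comment> \<open>A convex cone is closed under addition, so this is a legitimate test point for
    \<open>projector_dot\<close>; its difference to the projection is exactly
    \<open>v\<close>.\<close>
  have "projector K x + v \<in> K"
    using K(2,3) projector_mem[OF K(1,2,4)] assms by (meson convex_cone)
  from projector_dot[OF this, of x] show ?thesis
    by (simp add: inner_diff_left)
qed

lemma inner_projector_self: "x \<bullet> projector K x = (norm (projector K x))\<^sup>2"
proof -
  have p: "projector K x \<in> K"
    by (rule projector_mem[OF K(1,2,4)])
  then have "0 \<in> K"
    using mem_cone[OF K(3) p, of 0] by simp
  \<comment> \<open>The test point 0 bounds the inner product from below, and
    \<open>v = projector K x\<close> bounds it from above.\<close>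
  from projector_dot[OF this, of x] inner_projector_ge[OF p, of x] show ?thesis
    by (simp add: inner_diff_left power2_norm_eq_inner)
qed

lemma norm_projector_le: "norm (projector K x) \<le> norm x"
proof -
  have "(norm (projector K x))\<^sup>2 \<le> norm x * norm (projector K x)"
    using norm_cauchy_schwarz[of x "projector K x"] by (simp add: inner_projector_self)
  then show ?thesis
    by (cases "projector K x = 0") (auto simp: power2_eq_square)
qed

lemma inner_le_norm_projector:
  assumes "v \<in> K" "norm v \<le> 1"
  shows "x \<bullet> v \<le> norm (projector K x)"
proof -
  have "x \<bullet> v \<le> norm (projector K x) * norm v"
    using inner_projector_ge[OF assms(1)] norm_cauchy_schwarz order_trans by blast
  also have "\<dots> \<le> norm (projector K x)"
    using assms(2) by (simp add: mult_left_le)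
  finally show ?thesis .
qed

end

section \<open>Bounds for the cosine of the minimal angle\<close>

lemma inner_le_1:
  fixes x y :: "'a::real_inner"
  assumes "norm x \<le> 1" "norm y \<le> 1"
  shows "x \<bullet> y \<le> 1"
proof -
  have "norm x * norm y \<le> 1 * 1"
    using assms by (intro mult_mono) auto
  then show ?thesis
    using norm_cauchy_schwarz[of x y] by linarith
qed

lemma inner_le_cos_min_angle:
  assumes "x \<in> closed_cone_hull C" "norm x \<le> 1" "y \<in> closed_cone_hull D" "norm y \<le> 1"
  shows "x \<bullet> y \<le> cos_min_angle C D"
  unfolding cos_min_angle_def
  by (rule cSup_upper) (use assms in \<open>auto intro!: bdd_aboveI[of _ 1] inner_le_1\<close>)

lemma cos_min_angle_least:
  assumes "C \<noteq> {}" "D \<noteq> {}"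
    and "\<And>x y. x \<in> closed_cone_hull C \<Longrightarrow> norm x \<le> 1 \<Longrightarrow>
      y \<in> closed_cone_hull D \<Longrightarrow> norm y \<le> 1 \<Longrightarrow> x \<bullet> y \<le> c"
  shows "cos_min_angle C D \<le> c"
  unfolding cos_min_angle_def
proof (rule cSup_least)
  have "(0::'a) \<in> closed_cone_hull C \<inter> cball 0 1 \<and> (0::'a) \<in> closed_cone_hull D \<inter> cball 0 1"
    using zero_mem_closed_cone_hull assms by auto
  then show "{x \<bullet> y | x y. x \<in> closed_cone_hull C \<inter> cball 0 1 \<and> y \<in> closed_cone_hull D \<inter> cball 0 1} \<noteq> {}"
    by blast
qed (use assms(3) in auto)

lemma cos_min_angle_nonneg:
  assumes "C \<noteq> {}" "D \<noteq> {}"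
  shows "0 \<le> cos_min_angle C D"
  using inner_le_cos_min_angle[of 0 C 0 D] assms by (simp add: zero_mem_closed_cone_hull)

lemma inner_le_cos_min_angle_norm:
  assumes "x \<in> closed_cone_hull C" "y \<in> closed_cone_hull D"
  shows "x \<bullet> y \<le> cos_min_angle C D * norm x * norm y"
proof (cases "x = 0 \<or> y = 0")
  case False
  then have "sgn x \<bullet> sgn y \<le> cos_min_angle C D"
    using assms by (intro inner_le_cos_min_angle sgn_mem_closed_cone_hull) (auto simp: norm_sgn)
  then show ?thesis
    using False by (simp add: sgn_div_norm field_simps)
qed auto

section \<open>The cosine by successive projections\<close>

theorem cos_min_angle_eq_Sup_projector:
  fixes C D :: "'a::{real_inner, complete_space} set"
  assumes "(UNIV :: 'a set) \<noteq> {0}" "convex C" "C \<noteq> {}" "convex D" "D \<noteq> {}"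
  shows "cos_min_angle C D =
      Sup {sqrt (projector (closed_cone_hull C) x \<bullet>
                 projector (closed_cone_hull D) (projector (closed_cone_hull C) x))
           | x. x \<in> sphere 0 1}" (is "_ = Sup ?S")
proof -
  let ?K = "closed_cone_hull C" and ?L = "closed_cone_hull D"
  have K: "closed ?K" "convex ?K" "cone ?K" "?K \<noteq> {}"
    using assms closed_cone_hull convex_closed_cone_hull cone_closed_cone_hull
      zero_mem_closed_cone_hull by blast+
  have L: "closed ?L" "convex ?L" "cone ?L" "?L \<noteq> {}"
    using assms closed_cone_hull convex_closed_cone_hull cone_closed_cone_hull
      zero_mem_closed_cone_hull by blast+
  let ?f = "\<lambda>x. norm (projector ?L (projector ?K x))"
  \<comment> \<open>The radicand is the squared norm of the second projection, by
    \<open>inner_projector_self\<close>.\<close>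
  have S: "?S = ?f ` sphere 0 1"
    by (auto simp: inner_projector_self[OF L])
  \<comment> \<open>A nonzero space has a unit vector, so the supremum ranges over a nonempty
    set.\<close>
  obtain a :: 'a where "a \<noteq> 0"
    using assms(1) by blast
  then have e: "sgn a \<in> sphere 0 1"
    by (simp add: norm_sgn)
  have f_le: "?f x \<le> cos_min_angle C D" if "x \<in> sphere 0 1" for x
  proof (cases "projector ?L (projector ?K x) = 0")
    case True
    then show ?thesis using cos_min_angle_nonneg assms by simp
  next
    case False
    let ?k = "projector ?K x"
    let ?l = "projector ?L ?k"
    \<comment> \<open>The pair \<open>?k\<close>, \<open>sgn ?l\<close> is admissible for the
      cosine, and its inner product is \<open>norm ?l\<close>.\<close>
    have "?k \<bullet> sgn ?l \<le> cos_min_angle C D"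
    proof (rule inner_le_cos_min_angle)
      show "?k \<in> ?K" by (rule projector_mem[OF K(1,2,4)])
      show "norm ?k \<le> 1" using norm_projector_le[OF K, of x] that by simp
      show "sgn ?l \<in> ?L"
        using projector_mem[OF L(1,2,4)] False by (rule sgn_mem_closed_cone_hull)
      show "norm (sgn ?l) \<le> 1" by (simp add: norm_sgn)
    qed
    moreover have "?k \<bullet> sgn ?l = norm ?l"
      using False by (simp add: sgn_div_norm inner_projector_self[OF L] power2_eq_square)
    ultimately show ?thesis by simp
  qed
  then have bdd: "bdd_above (?f ` sphere 0 1)"
    by (auto intro!: bdd_aboveI)
  have "cos_min_angle C D \<le> Sup (?f ` sphere 0 1)"
  proof (rule cos_min_angle_least[OF assms(3,5)])
    fix x y
    assume x: "x \<in> ?K" "norm x \<le> 1" and y: "y \<in> ?L" "norm y \<le> 1"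
    have nonneg: "0 \<le> Sup (?f ` sphere 0 1)"
      using cSUP_upper[OF e bdd] norm_ge_zero order_trans by blast
    show "x \<bullet> y \<le> Sup (?f ` sphere 0 1)"
    proof (cases "x = 0")
      case True
      then show ?thesis using nonneg by simp
    next
      case False
      \<comment> \<open>The supremum is tested at \<open>sgn x\<close>, which the first projection
        fixes. Scaling back by \<open>norm x\<close>, at most 1, preserves the bound since the
        supremum is nonnegative.\<close>
      have "projector ?K (sgn x) = sgn x"
        using x False by (intro projector_ident[OF K(1,2)] sgn_mem_closed_cone_hull)
      then have "sgn x \<bullet> y \<le> ?f (sgn x)"
        using inner_le_norm_projector[OF L y, of "sgn x"] by simp
      also have "\<dots> \<le> Sup (?f ` sphere 0 1)"
        using False by (intro cSUP_upper[OF _ bdd]) (simp add: norm_sgn)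
      finally have le: "sgn x \<bullet> y \<le> Sup (?f ` sphere 0 1)" .
      have "x \<bullet> y = norm x * (sgn x \<bullet> y)"
        using False by (simp add: sgn_div_norm)
      also have "\<dots> \<le> norm x * Sup (?f ` sphere 0 1)"
        using le by (simp add: mult_left_mono)
      also have "\<dots> \<le> Sup (?f ` sphere 0 1)"
        using nonneg x(2) by (simp add: mult_left_le_one_le)
      finally show ?thesis .
    qed
  qed
  moreover have "Sup (?f ` sphere 0 1) \<le> cos_min_angle C D"
    using e f_le by (intro cSUP_least) auto
  ultimately show ?thesis
    unfolding S by simp
qed

section \<open>Unit spheres and the formulas for the angle\<close>

lemma cos_min_angle_eq_Sup_sphere:
  assumes "C \<noteq> {}" "C \<noteq> {0}" "D \<noteq> {}" "D \<noteq> {0}" and pos: "cos_min_angle C D > 0"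
  shows "cos_min_angle C D = Sup {x \<bullet> y | x y.
      x \<in> closed_cone_hull C \<inter> sphere 0 1 \<and> y \<in> closed_cone_hull D \<inter> sphere 0 1}" (is "?c = Sup ?S")
proof (rule antisym)
  have mem: "x \<bullet> y \<in> ?S"
    if "x \<in> closed_cone_hull C" "norm x = 1" "y \<in> closed_cone_hull D" "norm y = 1" for x y
    using that unfolding Int_iff mem_sphere_0 by blast
  have upper: "s \<le> ?c" if "s \<in> ?S" for s
    using that by (auto intro!: inner_le_cos_min_angle)
  have bdd: "bdd_above ?S"
    using upper by (rule bdd_aboveI)
  obtain u v where "u \<in> closed_cone_hull C" "norm u = 1" "v \<in> closed_cone_hull D" "norm v = 1"
    using closed_cone_hull_has_unit_vector assms by metis
  then have "u \<bullet> v \<in> ?S"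
    by (rule mem)
  then show "Sup ?S \<le> ?c"
    using upper by (intro cSup_least) blast+
  \<comment> \<open>Normalising divides the inner product by a number in (0, 1], which cannot
    decrease it when it is positive.\<close>
  have le: "x \<bullet> y \<le> Sup ?S" if x: "x \<in> closed_cone_hull C" "norm x \<le> 1"
    and y: "y \<in> closed_cone_hull D" "norm y \<le> 1" and xy: "0 < x \<bullet> y" for x y
  proof -
    have nz: "x \<noteq> 0" "y \<noteq> 0"
      using xy by auto
    have "sgn x \<bullet> sgn y \<in> ?S"
      using x(1) y(1) nz by (intro mem sgn_mem_closed_cone_hull) (simp_all add: norm_sgn)
    then have "sgn x \<bullet> sgn y \<le> Sup ?S"
      using bdd by (rule cSup_upper)
    moreover have "norm x * norm y \<le> 1"
      using x(2) y(2) by (simp add: mult_le_one)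
    then have "x \<bullet> y \<le> (x \<bullet> y) / (norm x * norm y)"
      using nz xy by (simp add: pos_le_divide_eq mult_left_le)
    moreover have "(x \<bullet> y) / (norm x * norm y) = sgn x \<bullet> sgn y"
      by (simp add: sgn_div_norm divide_inverse)
    ultimately show ?thesis by linarith
  qed
  \<comment> \<open>Positivity of the cosine enters here: some pair has a positive inner product, so
    \<open>Sup ?S\<close> is nonnegative and dominates all pairs with nonpositive inner product
    too.\<close>
  obtain x y where "x \<in> closed_cone_hull C" "norm x \<le> 1" "y \<in> closed_cone_hull D" "norm y \<le> 1" "0 < x \<bullet> y"
    using cos_min_angle_least[OF assms(1,3), of 0] pos by (meson not_le)
  then have nonneg: "0 \<le> Sup ?S"
    using le by (meson less_le_trans less_imp_le)
  show "?c \<le> Sup ?S"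
  proof (rule cos_min_angle_least[OF assms(1,3)])
    fix x y
    assume "x \<in> closed_cone_hull C" "norm x \<le> 1" "y \<in> closed_cone_hull D" "norm y \<le> 1"
    then show "x \<bullet> y \<le> Sup ?S"
      using le[of x y] nonneg by (cases "0 < x \<bullet> y") linarith+
  qed
qed

theorem theorem3p1:
  fixes C D :: "'a::{real_inner, complete_space} set"
    and \<alpha> \<beta> \<gamma> :: real
  assumes "(UNIV :: 'a set) \<noteq> {0}"
    and "convex C" and "C \<noteq> {}" and "C \<noteq> {0}"
    and "convex D" and "D \<noteq> {}" and "D \<noteq> {0}"
  defines "\<alpha> \<equiv> Sup {x \<bullet> y | x y.
      x \<in> closed_cone_hull C \<inter> sphere 0 1 \<and> y \<in> closed_cone_hull D \<inter> sphere 0 1}"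
    and "\<beta> \<equiv> Inf {norm (x - y) | x y.
      x \<in> closed_cone_hull C \<inter> sphere 0 1 \<and> y \<in> closed_cone_hull D \<inter> sphere 0 1}"
    and "\<gamma> \<equiv> Inf {norm (x - y) / (norm x + norm y) | x y.
      x \<in> closed_cone_hull C \<and> y \<in> closed_cone_hull D \<and> (x, y) \<noteq> (0, 0)}"
  shows "cos_min_angle C D =
      Sup {sqrt (projector (closed_cone_hull C) x \<bullet>
                 projector (closed_cone_hull D) (projector (closed_cone_hull C) x))
           | x. x \<in> sphere 0 1}
    \<and> (cos_min_angle C D \<noteq> 0 \<longrightarrow>
         cos_min_angle C D = \<alpha> \<and> \<alpha> = 1 - \<beta>\<^sup>2 / 2 \<and> 1 - \<beta>\<^sup>2 / 2 = 1 - 2 * \<gamma>\<^sup>2)"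
proof -
  let ?K = "closed_cone_hull C" and ?L = "closed_cone_hull D" and ?c = "cos_min_angle C D"
  let ?B = "{norm (x - y) | x y. x \<in> ?K \<inter> sphere 0 1 \<and> y \<in> ?L \<inter> sphere 0 1}"
  let ?G = "{norm (x - y) / (norm x + norm y) | x y. x \<in> ?K \<and> y \<in> ?L \<and> (x, y) \<noteq> (0, 0)}"
  have i: "?c = Sup {sqrt (projector ?K x \<bullet> projector ?L (projector ?K x)) | x. x \<in> sphere 0 1}"
    using assms by (intro cos_min_angle_eq_Sup_projector)
  \<comment> \<open>With c the cosine, the three bounds below close a cycle, 4 \<gamma>^2 \<le>
    \<beta>^2 \<le> 2 (1 - c) \<le> 4 \<gamma>^2, which forces equality throughout.\<close>
  have "?c = \<alpha> \<and> \<alpha> = 1 - \<beta>\<^sup>2 / 2 \<and> 1 - \<beta>\<^sup>2 / 2 = 1 - 2 * \<gamma>\<^sup>2" if "?c \<noteq> 0"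
  proof -
    have c0: "0 < ?c"
      using that cos_min_angle_nonneg[of C D] assms(3,6) by simp
    have c1: "?c \<le> 1"
      using assms(3,6) by (intro cos_min_angle_least inner_le_1)
    have \<alpha>: "?c = \<alpha>"
      unfolding \<alpha>_def using assms(3,4,6,7) c0 by (intro cos_min_angle_eq_Sup_sphere)
    obtain u v where uv: "u \<in> ?K" "norm u = 1" "v \<in> ?L" "norm v = 1"
      using closed_cone_hull_has_unit_vector assms(3,4,6,7) by metis
    then have B: "norm (u - v) \<in> ?B"
      by auto
    have bddB: "bdd_below ?B"
      by (rule bdd_belowI[of _ 0]) auto
    have bddG: "bdd_below ?G"
      by (rule bdd_belowI[of _ 0]) auto
    have norm_diff: "(norm (x - y))\<^sup>2 = (norm x)\<^sup>2 + (norm y)\<^sup>2 - 2 * (x \<bullet> y)" for x y :: 'a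
      by (simp add: power2_norm_eq_inner inner_diff_left inner_diff_right inner_commute)
    have "0 \<le> \<beta>"
      unfolding \<beta>_def using B by (intro cInf_greatest) auto
    have "?c \<le> 1 - \<beta>\<^sup>2 / 2"
      unfolding \<alpha> \<alpha>_def
    proof (rule cSup_least)
      show "{x \<bullet> y | x y. x \<in> ?K \<inter> sphere 0 1 \<and> y \<in> ?L \<inter> sphere 0 1} \<noteq> {}"
        using uv by auto
    next
      fix s
      assume "s \<in> {x \<bullet> y | x y. x \<in> ?K \<inter> sphere 0 1 \<and> y \<in> ?L \<inter> sphere 0 1}"
      then obtain x y where xy: "s = x \<bullet> y" "x \<in> ?K" "norm x = 1" "y \<in> ?L" "norm y = 1"
        by auto
      have "\<beta> \<le> norm (x - y)"
        unfolding \<beta>_def by (rule cInf_lower[OF _ bddB]) (use xy in auto)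
      then have "\<beta>\<^sup>2 \<le> (norm (x - y))\<^sup>2"
        using \<open>0 \<le> \<beta>\<close> by (intro power_mono)
      then show "s \<le> 1 - \<beta>\<^sup>2 / 2"
        using xy by (simp add: norm_diff)
    qed
    \<comment> \<open>For unit vectors the denominator in \<open>?G\<close> is 2.\<close>
    moreover have "2 * \<gamma> \<le> \<beta>"
      unfolding \<beta>_def
    proof (rule cInf_greatest)
      show "?B \<noteq> {}"
        using B by blast
    next
      fix s assume "s \<in> ?B"
      then obtain x y where xy: "s = norm (x - y)" "x \<in> ?K" "norm x = 1" "y \<in> ?L" "norm y = 1"
        by auto
      then have "norm (x - y) / (norm x + norm y) \<in> ?G"
        by fastforce
      then have "\<gamma> \<le> norm (x - y) / (norm x + norm y)"
        unfolding \<gamma>_def using bddG by (rule cInf_lower)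
      then show "2 * \<gamma> \<le> s"
        using xy by simp
    qed
    moreover have "sqrt ((1 - ?c) / 2) \<le> \<gamma>"
      unfolding \<gamma>_def
    proof (rule cInf_greatest)
      show "?G \<noteq> {}"
        using uv by force
    next
      fix s assume "s \<in> ?G"
      then obtain x y where xy: "s = norm (x - y) / (norm x + norm y)" "x \<in> ?K" "y \<in> ?L"
        "(x, y) \<noteq> (0, 0)"
        by auto
      have pos: "0 < norm x + norm y"
        using xy(4) by (auto intro: add_pos_nonneg add_nonneg_pos)
      \<comment> \<open>This square is exactly the gap between the lower bound for the squared norm
        of \<open>x - y\<close> given by the homogeneous estimate and the target (1 - c)/2 times the
        squared sum of the norms.\<close>
      have "0 \<le> (1 + ?c) / 2 * (norm x - norm y)\<^sup>2"
        using c0 by simp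
      also have "\<dots> = (norm x)\<^sup>2 + (norm y)\<^sup>2 - 2 * (?c * norm x * norm y)
          - (1 - ?c) / 2 * (norm x + norm y)\<^sup>2"
        by (simp add: power2_eq_square field_simps)
      finally have "(1 - ?c) / 2 * (norm x + norm y)\<^sup>2 \<le> (norm (x - y))\<^sup>2"
        using inner_le_cos_min_angle_norm[OF xy(2,3)] by (simp add: norm_diff)
      then have "(1 - ?c) / 2 \<le> s\<^sup>2"
        using pos by (simp add: xy(1) power_divide pos_le_divide_eq)
      then show "sqrt ((1 - ?c) / 2) \<le> s"
        using pos by (intro real_le_lsqrt) (auto simp: xy(1))
    qed
    moreover from this have "(1 - ?c) / 2 \<le> \<gamma>\<^sup>2"
      by (rule sqrt_le_D)
    \<comment> \<open>\<open>c1\<close> makes the root nonnegative, so \<gamma> is nonnegative and 2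
      \<gamma> \<le> \<beta> may be squared.\<close>
    moreover have "0 \<le> \<gamma>"
      using order_trans[OF _ \<open>sqrt ((1 - ?c) / 2) \<le> \<gamma>\<close>, of 0] c1 by simp
    moreover from \<open>2 * \<gamma> \<le> \<beta>\<close> \<open>0 \<le> \<gamma>\<close> have "4 * \<gamma>\<^sup>2 \<le> \<beta>\<^sup>2"
      using power_mono[of "2 * \<gamma>" \<beta> 2] by (simp add: power_mult_distrib)
    ultimately have "?c = 1 - \<beta>\<^sup>2 / 2 \<and> 1 - \<beta>\<^sup>2 / 2 = 1 - 2 * \<gamma>\<^sup>2"
      by (simp add: field_simps)
    with \<alpha> show ?thesis by metis
  qed
  with i show ?thesis by blast
qed

end
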